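(* Let $X$ be a normed linear space, let $A,B\subset X$ be closed, and let $a\in A$ and $b\in B$. The pair $\{A,B\}$ is approximately stationary relative to $a$ and $b$ if and only if for any $\varepsilon>0$, any $\delta>0$ and any points $a'\in A\cap\mathbb{B}_\varepsilon(a)$, $b'\in B\cap\mathbb{B}_\varepsilon(b)$ there exist $\rho\in(0,\delta)$, $a''\in A\cap\mathbb{B}_\varepsilon(a')$, $b''\in B\cap\mathbb{B}_\varepsilon(b')$ and $u,v\in X$ such that $$(A-a''-u)\cap(B-b''-v)\cap(\rho\mathbb{B})=\emptyset\quad\text{and}\quad\max\{\|u\|,\|v\|\}<\varepsilon\rho.$$
   Context: $\mathbb{B}$ is the closed unit ball of $X$, $\rho\mathbb{B}$ is the closed ball of radius $\rho$ centered at $0$, and $\mathbb{B}_\delta(x)$ is the open ball of radius $\delta$ centered at $x$. The pair $\{A,B\}$ is approximately stationary relative to $a\in A$ and $b\in B$ if for any $\varepsilon>0$ there exist $\rho\in(0,\varepsilon)$, points $a'\in A\cap\mathbb{B}_\varepsilon(a)$, $b'\in B\cap\mathbb{B}_\varepsilon(b)$ and $u,v\in X$ such that $$(A-a'-u)\cap(B-b'-v)\cap(\rho\mathbb{B})=\emptyset\quad\text{and}\quad\max\{\|u\|,\|v\|\}<\varepsilon\rho.$$ *)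

theory Defs
  imports "HOL-Analysis.Analysis"
begin

definition approximately_stationary ::
    "'a::real_normed_vector set \<Rightarrow> 'a set \<Rightarrow> 'a \<Rightarrow> 'a \<Rightarrow> bool" where
  "approximately_stationary A B a b \<longleftrightarrow>
    (\<forall>\<epsilon>>0. \<exists>\<rho>\<in>{0<..<\<epsilon>}. \<exists>a'\<in>A \<inter> ball a \<epsilon>. \<exists>b'\<in>B \<inter> ball b \<epsilon>. \<exists>u v.
      (\<lambda>x. x - a' - u) ` A \<inter> (\<lambda>x. x - b' - v) ` B \<inter> cball 0 \<rho> = {} \<and>
      max (norm u) (norm v) < \<epsilon> * \<rho>)"

end

theory Submission
  imports Defs
begin

text \<open>The centres \<open>a'\<close> and \<open>b'\<close> lie in the open balls about \<open>a\<close> and \<open>b\<close>, so a small enough ball about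
\<open>a\<close> lies inside the \<open>\<epsilon>\<close>-ball about \<open>a'\<close>, and likewise for \<open>b\<close>. Approximate stationarity tested
with such a small radius therefore already supplies the required points near \<open>a'\<close> and \<open>b'\<close>.
Conversely, \<open>a\<close> and \<open>b\<close> are themselves admissible centres.\<close>

theorem proposition13:
  fixes A B :: "'a::real_normed_vector set" and a b :: 'a
  assumes "closed A" and "closed B" and "a \<in> A" and "b \<in> B"
  shows "approximately_stationary A B a b \<longleftrightarrow>
    (\<forall>\<epsilon>>0. \<forall>\<delta>>0. \<forall>a'\<in>A \<inter> ball a \<epsilon>. \<forall>b'\<in>B \<inter> ball b \<epsilon>.
      \<exists>\<rho>\<in>{0<..<\<delta>}. \<exists>a''\<in>A \<inter> ball a' \<epsilon>. \<exists>b''\<in>B \<inter> ball b' \<epsilon>. \<exists>u v.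
        (\<lambda>x. x - a'' - u) ` A \<inter> (\<lambda>x. x - b'' - v) ` B \<inter> cball 0 \<rho> = {} \<and>
        max (norm u) (norm v) < \<epsilon> * \<rho>)"
    (is "_ \<longleftrightarrow> ?R")
proof
  assume st: "approximately_stationary A B a b"
  show ?R
  proof (intro allI impI ballI)
    fix \<epsilon> \<delta> :: real and a' b'
    assume "\<epsilon> > 0" "\<delta> > 0" and a': "a' \<in> A \<inter> ball a \<epsilon>" and b': "b' \<in> B \<inter> ball b \<epsilon>"
    define \<eta> where "\<eta> = min \<delta> (min (\<epsilon> - dist a a') (\<epsilon> - dist b b'))"
    have "\<eta> > 0"
      using \<open>\<delta> > 0\<close> a' b' by (simp add: \<eta>_def)
    then obtain \<rho> a'' b'' u v
      where \<rho>: "\<rho> \<in> {0<..<\<eta>}"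
        and a'': "a'' \<in> A \<inter> ball a \<eta>" and b'': "b'' \<in> B \<inter> ball b \<eta>"
        and disj: "(\<lambda>x. x - a'' - u) ` A \<inter> (\<lambda>x. x - b'' - v) ` B \<inter> cball 0 \<rho> = {}"
        and uv: "max (norm u) (norm v) < \<eta> * \<rho>"
      using st unfolding approximately_stationary_def by blast
    have \<eta>_le: "\<eta> \<le> \<delta>" "\<eta> \<le> \<epsilon> - dist a a'" "\<eta> \<le> \<epsilon> - dist b b'"
      by (auto simp: \<eta>_def)
    have "\<eta> \<le> \<epsilon>"
      using \<eta>_le(2) zero_le_dist[of a a'] by linarith
    then have "\<eta> * \<rho> \<le> \<epsilon> * \<rho>"
      using \<rho> by (intro mult_right_mono) auto
    then have "max (norm u) (norm v) < \<epsilon> * \<rho>"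
      using uv by linarith
    moreover have "\<rho> \<in> {0<..<\<delta>}"
      using \<rho> \<eta>_le(1) by auto
    moreover have "a'' \<in> A \<inter> ball a' \<epsilon>"
      using a'' \<eta>_le(2) dist_triangle3[of a' a'' a] by auto
    moreover have "b'' \<in> B \<inter> ball b' \<epsilon>"
      using b'' \<eta>_le(3) dist_triangle3[of b' b'' b] by auto
    ultimately show "\<exists>\<rho>\<in>{0<..<\<delta>}. \<exists>a''\<in>A \<inter> ball a' \<epsilon>. \<exists>b''\<in>B \<inter> ball b' \<epsilon>. \<exists>u v.
        (\<lambda>x. x - a'' - u) ` A \<inter> (\<lambda>x. x - b'' - v) ` B \<inter> cball 0 \<rho> = {} \<and>
        max (norm u) (norm v) < \<epsilon> * \<rho>"
      using disj by blast
  qed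
next
  assume R: ?R
  show "approximately_stationary A B a b"
    unfolding approximately_stationary_def
  proof (intro allI impI)
    fix \<epsilon> :: real
    assume "\<epsilon> > 0"
    then have "a \<in> A \<inter> ball a \<epsilon>" "b \<in> B \<inter> ball b \<epsilon>"
      using assms by auto
    with R \<open>\<epsilon> > 0\<close>
    show "\<exists>\<rho>\<in>{0<..<\<epsilon>}. \<exists>a'\<in>A \<inter> ball a \<epsilon>. \<exists>b'\<in>B \<inter> ball b \<epsilon>. \<exists>u v.
      (\<lambda>x. x - a' - u) ` A \<inter> (\<lambda>x. x - b' - v) ` B \<inter> cball 0 \<rho> = {} \<and>
      max (norm u) (norm v) < \<epsilon> * \<rho>"
      by blast
  qed
qed

end
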